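(* Let $\mathcal{G}$ be a graph and $k\ge 1$ an integer. Let $\mathcal{G}_k$ be the graph obtained from $\mathcal{G}$ by adding $k+1$ additional vertices, which play the role of the boundary, each attached by an edge to every vertex of $\mathcal{G}$, and given distinct real boundary values. Then $|\chi_{\mathcal{G}}(-k)|$ is the number of compatible orientations of $\mathcal{G}_k$, where $\chi_{\mathcal{G}}$ is the chromatic polynomial of $\mathcal{G}$.
   Context: Graphs are finite and simple. No edges are added between the $k+1$ new (boundary) vertices of $\mathcal{G}_k$; the interior vertices of $\mathcal{G}_k$ are the vertices of $\mathcal{G}$. For a graph with boundary vertices $V_b$ and a function $u:V_b\to\mathbb{R}$ (the boundary values), a compatible orientation is an acyclic orientation of the edges of the graph such that no interior vertex is a source or a sink, and there is no oriented path from a boundary vertex to another boundary vertex of higher or equal $u$-value. *)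

theory Defs
  imports
    "HOL-Computational_Algebra.Polynomial"
    "HOL-Library.FuncSet"
    "Graph_Theory.Pair_Digraph"
begin

text \<open>
  A finite simple graph is a \<^locale>\<open>pair_graph\<close>: a finite symmetric loop-free relation, in which an
  undirected edge \<open>{x, y}\<close> is represented by the two arcs \<open>(x, y)\<close> and \<open>(y, x)\<close>.
\<close>

definition proper_colorings :: "'a pair_pre_digraph \<Rightarrow> nat \<Rightarrow> ('a \<Rightarrow> nat) set" where
  "proper_colorings G q = {f \<in> pverts G \<rightarrow>\<^sub>E {..<q}. \<forall>(x, y) \<in> parcs G. f x \<noteq> f y}"

definition chromatic_polynomial :: "'a pair_pre_digraph \<Rightarrow> int poly" where
  "chromatic_polynomial G =
     (THE p. \<forall>q. poly p (int q) = int (card (proper_colorings G q)))"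

lemma card_functions_constant_on_arcs:
  fixes S :: "'a rel"
  assumes V: "finite V" and S: "S \<subseteq> V \<times> V"
  shows "\<exists>m. \<forall>q. card {f \<in> V \<rightarrow>\<^sub>E {..<q::nat}. \<forall>(x, y) \<in> S. f x = f y} = q ^ m"
proof -
  define r where
    "r = {(x, y) \<in> V \<times> V. \<forall>f :: 'a \<Rightarrow> nat. (\<forall>(u, v) \<in> S. f u = f v) \<longrightarrow> f x = f y}"
  have eq: "equiv V r"
    by (rule equivI) (auto simp: r_def refl_on_def sym_def trans_def)
  have fin: "finite (V // r)"
    using V by (simp add: finite_quotient r_def finite_subset[of _ "V \<times> V"] quotient_def)
  have "card {f \<in> V \<rightarrow>\<^sub>E {..<q::nat}. \<forall>(x, y) \<in> S. f x = f y} = q ^ card (V // r)" for q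
  proof -
    define A where "A = {f \<in> V \<rightarrow>\<^sub>E {..<q}. \<forall>(x, y) \<in> S. f x = f y}"
    define B where "B = ((V // r) \<rightarrow>\<^sub>E {..<q})"
    define F where "F = (\<lambda>g. \<lambda>x\<in>V. g (r `` {x}) :: nat)"
    have "bij_betw F B A"
    proof (rule bij_betwI')
      fix g h assume gh: "g \<in> B" "h \<in> B"
      show "(F g = F h) = (g = h)"
      proof
        assume *: "F g = F h"
        show "g = h"
        proof (rule PiE_ext)
          show "g \<in> (V // r) \<rightarrow>\<^sub>E {..<q}" "h \<in> (V // r) \<rightarrow>\<^sub>E {..<q}"
            using gh by (auto simp: B_def)
          fix C assume "C \<in> V // r"
          then obtain x where "x \<in> V" "C = r `` {x}" by (auto elim: quotientE)
          then show "g C = h C"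
            using fun_cong[OF *, of x] by (simp add: F_def)
        qed
      qed simp
    next
      fix g assume g: "g \<in> B"
      have lt: "g (r `` {x}) < q" if "x \<in> V" for x
        using PiE_mem[OF g[unfolded B_def], of "r `` {x}"] that by (auto simp: quotientI)
      have "r `` {x} = r `` {y}" if "(x, y) \<in> S" for x y
      proof -
        have "(x, y) \<in> r" using that S by (auto simp: r_def)
        then show ?thesis by (rule equiv_class_eq[OF eq])
      qed
      then have "F g x = F g y" if "(x, y) \<in> S" for x y
        using that S by (auto simp: F_def)
      moreover have "F g \<in> V \<rightarrow>\<^sub>E {..<q}"
        using lt by (simp add: F_def)
      ultimately show "F g \<in> A"
        by (auto simp: A_def)
    next
      fix f assume f: "f \<in> A"
      define g where "g = (\<lambda>C \<in> V // r. f (SOME x. x \<in> C))"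
      have c: "f (SOME z. z \<in> r `` {x}) = f x" if "x \<in> V" for x
      proof -
        have "x \<in> r `` {x}" using equiv_class_self[OF eq that] .
        then have "(SOME z. z \<in> r `` {x}) \<in> r `` {x}" by (rule someI)
        then show ?thesis using f by (auto simp: r_def A_def)
      qed
      have "g \<in> B"
      proof -
        have "f (SOME x. x \<in> C) < q" if "C \<in> V // r" for C
        proof -
          obtain x where "x \<in> V" "C = r `` {x}" using \<open>C \<in> V // r\<close> by (auto elim: quotientE)
          then show ?thesis using c[of x] f by (auto simp: A_def)
        qed
        then show ?thesis by (auto simp: B_def g_def)
      qed
      moreover have "f = F g"
      proof
        fix x
        show "f x = F g x"
        proof (cases "x \<in> V")
          case True
          then show ?thesis using c[of x] by (simp add: F_def g_def quotientI)
        next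
          case False
          then show ?thesis using f by (auto simp: F_def A_def PiE_def extensional_def)
        qed
      qed
      ultimately show "\<exists>g\<in>B. f = F g" by blast
    qed
    then have "card A = card B" by (metis bij_betw_same_card)
    then show ?thesis using fin by (simp add: A_def B_def card_funcsetE)
  qed
  then show ?thesis by blast
qed

lemma chromatic_polynomial_exists:
  assumes "pair_graph G"
  shows "\<exists>p :: int poly. \<forall>q. poly p (int q) = int (card (proper_colorings G q))"
proof -
  interpret pair_graph G by fact
  define N where "N = (\<lambda>S (q::nat). {f \<in> pverts G \<rightarrow>\<^sub>E {..<q}. \<forall>(x, y) \<in> S. f x = f y})"
  have "parcs G \<subseteq> pverts G \<times> pverts G"
    using arc_fst_in_verts arc_snd_in_verts by fastforce
  then have "\<exists>m. \<forall>q. card (N S q) = q ^ m" if "S \<subseteq> parcs G" for S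
    unfolding N_def using card_functions_constant_on_arcs[OF pair_finite_verts] that by blast
  then obtain m where m: "\<And>S q. S \<subseteq> parcs G \<Longrightarrow> card (N S q) = q ^ m S" by metis
  define p :: "int poly" where "p = (\<Sum>S\<in>Pow (parcs G). monom ((-1) ^ card S) (m S))"
  have "poly p (int q) = int (card (proper_colorings G q))" for q
  proof -
    let ?F = "pverts G \<rightarrow>\<^sub>E {..<q}"
    let ?e = "\<lambda>f :: 'a \<Rightarrow> nat. \<lambda>a. of_bool (f (fst a) = f (snd a)) :: int"
    have finF: "finite ?F" by (simp add: finite_PiE)
    have ind: "(\<Prod>a\<in>S. ?e f a) = of_bool (\<forall>(x, y) \<in> S. f x = f y)"
      if "S \<subseteq> parcs G" for S and f :: "'a \<Rightarrow> nat"
    proof -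
      have "finite S" using that pair_finite_arcs finite_subset by blast
      then show ?thesis by (induction S) auto
    qed
    have "(of_bool (\<forall>(x, y) \<in> parcs G. f x \<noteq> f y) :: int) =
            (\<Sum>S\<in>Pow (parcs G). (-1) ^ card S * of_bool (\<forall>(x, y) \<in> S. f x = f y))" for f :: "'a \<Rightarrow> nat"
    proof -
      have "(\<Prod>a\<in>A. 1 - ?e f a) = of_bool (\<forall>(x, y) \<in> A. f x \<noteq> f y)" if "finite A" for A
        using that by (induction A) auto
      then have "(of_bool (\<forall>(x, y) \<in> parcs G. f x \<noteq> f y) :: int) = (\<Prod>a\<in>parcs G. 1 - ?e f a)"
        using pair_finite_arcs by simp
      also have "\<dots> = (\<Sum>S\<in>Pow (parcs G). (-1) ^ card S * (\<Prod>a\<in>S. ?e f a))"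
        using prod_diff_conv_sum[OF pair_finite_arcs, of "\<lambda>_. 1" "?e f"] by simp
      also have "\<dots> = (\<Sum>S\<in>Pow (parcs G). (-1) ^ card S * of_bool (\<forall>(x, y) \<in> S. f x = f y))"
        by (intro sum.cong refl) (simp add: ind)
      finally show ?thesis .
    qed
    then have "(\<Sum>f\<in>?F. of_bool (\<forall>(x, y) \<in> parcs G. f x \<noteq> f y) :: int) =
            (\<Sum>f\<in>?F. \<Sum>S\<in>Pow (parcs G). (-1) ^ card S * of_bool (\<forall>(x, y) \<in> S. f x = f y))"
      by simp
    also have "\<dots> = (\<Sum>S\<in>Pow (parcs G). \<Sum>f\<in>?F. (-1) ^ card S * of_bool (\<forall>(x, y) \<in> S. f x = f y))"
      by (rule sum.swap)
    also have "\<dots> = (\<Sum>S\<in>Pow (parcs G). (-1) ^ card S * int (card (N S q)))"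
      using finF by (simp add: sum_distrib_left[symmetric] N_def sum_of_bool_eq Int_def)
    also have "\<dots> = poly p (int q)"
      by (simp add: p_def poly_sum poly_monom m)
    finally show ?thesis
      using finF by (simp add: proper_colorings_def sum_of_bool_eq Int_def)
  qed
  then show ?thesis by blast
qed

lemma poly_chromatic_polynomial:
  assumes "pair_graph G"
  shows "poly (chromatic_polynomial G) (int q) = int (card (proper_colorings G q))"
proof -
  obtain p :: "int poly" where p: "\<forall>q. poly p (int q) = int (card (proper_colorings G q))"
    using chromatic_polynomial_exists[OF assms] by blast
  have "p' = p" if p': "\<forall>q. poly p' (int q) = int (card (proper_colorings G q))" for p'
  proof (rule ccontr)
    assume "p' \<noteq> p"
    then have "finite {x. poly (p' - p) x = 0}" by (intro poly_roots_finite) simp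
    moreover have "range int \<subseteq> {x. poly (p' - p) x = 0}" using p p' by auto
    ultimately have "finite (range int)" by (rule rev_finite_subset)
    then show False using finite_imageD[of int UNIV] by (simp add: inj_on_def)
  qed
  then have "chromatic_polynomial G = p"
    unfolding chromatic_polynomial_def using p by (intro the_equality) blast+
  then show ?thesis using p by simp
qed

text \<open>
  The graph obtained from \<open>G\<close> by adding the \<open>k + 1\<close> new vertices \<open>Inr 0, \<dots>, Inr k\<close>, each joined to
  all (copies \<open>Inl v\<close> of) vertices of \<open>G\<close> and to nothing else.
\<close>

definition cone_boundary :: "nat \<Rightarrow> ('a + nat) set" where
  "cone_boundary k = Inr ` {..k}"

definition cone_graph :: "'a pair_pre_digraph \<Rightarrow> nat \<Rightarrow> ('a + nat) pair_pre_digraph" where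
  "cone_graph G k =
     \<lparr> pverts = Inl ` pverts G \<union> cone_boundary k,
       parcs = map_prod Inl Inl ` parcs G
             \<union> (Inl ` pverts G) \<times> cone_boundary k \<union> cone_boundary k \<times> (Inl ` pverts G) \<rparr>"

lemma pair_graph_cone_graph:
  assumes "pair_graph G"
  shows "pair_graph (cone_graph G k)"
proof -
  interpret pair_graph G by fact
  have sym: "(x, y) \<in> parcs G \<Longrightarrow> (y, x) \<in> parcs G" for x y
    using arcs_ends_symmetric[OF pair_sym_arcs] by simp
  have noloop: "(x, x) \<notin> parcs G" for x
    using pair_no_loops[of "(x, x)"] by auto
  show ?thesis
  proof unfold_locales
    show "symmetric (with_proj (cone_graph G k))"
      unfolding symmetric_def by (rule symI) (auto simp: cone_graph_def intro: sym)
  qed (use pair_finite_verts pair_finite_arcs noloop in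
        \<open>auto simp: cone_graph_def cone_boundary_def in_arcsD1 in_arcsD2\<close>)
qed

definition orientation :: "'a pair_pre_digraph \<Rightarrow> 'a pair_pre_digraph \<Rightarrow> bool" where
  "orientation G D \<longleftrightarrow> pverts D = pverts G \<and> parcs D \<subseteq> parcs G \<and>
     (\<forall>(x, y) \<in> parcs G. (x, y) \<in> parcs D \<longleftrightarrow> (y, x) \<notin> parcs D)"

definition source :: "'a pair_pre_digraph \<Rightarrow> 'a \<Rightarrow> bool" where
  "source D v \<longleftrightarrow> in_degree D v = 0"

definition sink :: "'a pair_pre_digraph \<Rightarrow> 'a \<Rightarrow> bool" where
  "sink D v \<longleftrightarrow> out_degree D v = 0"

text \<open>
  \<open>B\<close> is the set of boundary vertices and \<open>u\<close> gives the boundary values; only the values of \<open>u\<close> on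
  \<open>B\<close> are used.
\<close>

definition compatible_orientation ::
  "'a pair_pre_digraph \<Rightarrow> 'a set \<Rightarrow> ('a \<Rightarrow> real) \<Rightarrow> 'a pair_pre_digraph \<Rightarrow> bool" where
  "compatible_orientation G B u D \<longleftrightarrow>
     orientation G D \<and> acyclic (parcs D) \<and>
     (\<forall>v \<in> pverts G - B. \<not> source D v \<and> \<not> sink D v) \<and>
     \<not> (\<exists>b \<in> B. \<exists>c \<in> B. b \<noteq> c \<and> u b \<le> u c \<and> b \<rightarrow>\<^sup>+\<^bsub>with_proj D\<^esub> c)"

end

theory Submission
  imports Defs
begin

text \<open>
  Both sides count \<^emph>\<open>descending pairs\<close>: an acyclic orientation \<open>A\<close> of \<open>G\<close> together with a map \<open>c\<close>
  from the vertices to \<open>{0, \<dots>, k - 1}\<close> that never increases along an arc of \<open>A\<close>.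

  The chromatic side is Stanley's reciprocity theorem (\<open>chromatic_reciprocity\<close>): the number \<open>N(W, k)\<close>
  of descending pairs on the subgraph induced by \<open>W\<close> equals \<open>(-1)\<^sup>|\<^sup>W\<^sup>| \<chi>\<^sub>W(-k)\<close>.  Removing
  the top colour class from a proper colouring gives, first for natural numbers and then as an identity
  of polynomials, \<open>\<chi>\<^sub>W(x + 1) = \<Sum>\<^sub>T \<chi>\<^sub>W\<^sub>-\<^sub>T(x)\<close>, where \<open>T\<close> ranges over the independent sets
  (\<open>chromatic_polynomial_shift\<close>).  Putting \<open>x = -(k + 1)\<close> relates the values at \<open>-k\<close> to those at
  \<open>-(k + 1)\<close>.  The signed numbers \<open>(-1)\<^sup>|\<^sup>W\<^sup>| N(W, k)\<close> obey the same recurrence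
  (\<open>descending_pairs_alternating_sum\<close>).  Indeed, a descending pair on \<open>W - T\<close> with \<open>k + 1\<close> colours
  is the same as one on \<open>W\<close> in which the members of \<open>T\<close> are sources of the top colour.  Summing over
  \<open>T\<close> with signs therefore leaves the pairs without sources of the top colour, and in these, by
  acyclicity, the top colour does not occur at all.

  On the orientation side, let the boundary vertices be \<open>b\<^sub>0, \<dots>, b\<^sub>k\<close> in the order of their values.
  Since boundary-to-boundary paths must go down, each vertex \<open>v\<close> of \<open>G\<close> points exactly to some
  initial segment \<open>b\<^sub>0, \<dots>, b\<^sub>c\<close> and receives arcs from the other boundary vertices.  The absence of
  interior sources and sinks forces \<open>0 \<le> c < k\<close>, and the resulting map \<open>v \<mapsto> c(v)\<close> descends along
  the arcs inside \<open>G\<close>, for otherwise there would be a directed triangle.  Conversely, each descending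
  pair arises in this way, because the thresholds serve as a height function on the cone
  (\<open>compatible_cone_orientation\<close>, \<open>compatible_orientation_is_cone_orientation\<close>).
\<close>

section \<open>Splitting a colouring along its top colour\<close>

definition induced :: "'a pair_pre_digraph \<Rightarrow> 'a set \<Rightarrow> 'a pair_pre_digraph" where
  "induced G W = \<lparr> pverts = W, parcs = Restr (parcs G) W \<rparr>"

definition independent_sets :: "'a set \<Rightarrow> 'a rel \<Rightarrow> 'a set set" where
  "independent_sets W E = {T. T \<subseteq> W \<and> Restr E T = {}}"

lemma pair_graph_induced:
  assumes "pair_graph G" and "W \<subseteq> pverts G"
  shows "pair_graph (induced G W)"
proof -
  interpret pair_graph G by fact
  have sym: "(x, y) \<in> parcs G \<Longrightarrow> (y, x) \<in> parcs G" for x y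
    using arcs_ends_symmetric[OF pair_sym_arcs] by simp
  have noloop: "(x, x) \<notin> parcs G" for x
    using pair_no_loops[of "(x, x)"] by auto
  have fin: "finite W"
    using assms(2) pair_finite_verts finite_subset by blast
  show ?thesis
  proof unfold_locales
    show "symmetric (with_proj (induced G W))"
      unfolding symmetric_def by (rule symI) (auto simp: induced_def intro: sym)
  qed (use fin noloop in \<open>auto simp: induced_def\<close>)
qed

lemma induced_pverts:
  assumes "pair_graph G"
  shows "induced G (pverts G) = G"
proof -
  interpret pair_graph G by fact
  have "parcs G \<subseteq> pverts G \<times> pverts G"
    using arc_fst_in_verts arc_snd_in_verts by fastforce
  then show ?thesis
    by (intro pair_pre_digraph.equality) (auto simp: induced_def)
qed

lemma finite_independent_sets: "finite W \<Longrightarrow> finite (independent_sets W E)"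
  unfolding independent_sets_def by (rule finite_subset[of _ "Pow W"]) auto

lemma finite_proper_colorings: "finite (pverts G) \<Longrightarrow> finite (proper_colorings G q)"
  unfolding proper_colorings_def by (rule finite_subset[of _ "pverts G \<rightarrow>\<^sub>E {..<q}"]) (auto simp: finite_PiE)

text \<open>
  The top colour class of a proper colouring is an independent set, and what remains is an arbitrary
  proper colouring of the rest with one colour less.
\<close>

lemma card_proper_colorings_Suc:
  assumes W: "finite W"
  shows "card (proper_colorings (induced G W) (Suc q)) =
           (\<Sum>T\<in>independent_sets W (parcs G). card (proper_colorings (induced G (W - T)) q))"
proof -
  let ?S = "SIGMA T:independent_sets W (parcs G). proper_colorings (induced G (W - T)) q"
  let ?f = "\<lambda>f. ({v \<in> W. f v = q}, restrict f (W - {v \<in> W. f v = q}))"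
  let ?g = "\<lambda>(T, h). \<lambda>v\<in>W. if v \<in> T then q else h v"
  have "bij_betw ?f (proper_colorings (induced G W) (Suc q)) ?S"
  proof (rule bij_betw_byWitness[where f' = ?g])
    show "\<forall>f\<in>proper_colorings (induced G W) (Suc q). ?g (?f f) = f"
      by (auto simp: proper_colorings_def induced_def fun_eq_iff PiE_def extensional_def restrict_def)
    show "\<forall>p\<in>?S. ?f (?g p) = p"
    proof
      fix p assume "p \<in> ?S"
      then obtain T h where p: "p = (T, h)" "T \<subseteq> W" "h \<in> (W - T) \<rightarrow>\<^sub>E {..<q}"
        by (auto simp: proper_colorings_def induced_def independent_sets_def)
      have *: "{v \<in> W. ?g p v = q} = T"
        using p(2) PiE_mem[OF p(3)] by (auto simp: p(1))
      have "restrict (?g p) (W - T) = h"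
        using p(3) by (auto simp: p(1) fun_eq_iff PiE_def extensional_def)
      then show "?f (?g p) = p" unfolding * by (simp add: p(1))
    qed
    show "?f ` proper_colorings (induced G W) (Suc q) \<subseteq> ?S"
    proof (rule image_subsetI)
      fix f assume f: "f \<in> proper_colorings (induced G W) (Suc q)"
      then have lt: "f v < Suc q" if "v \<in> W" for v
        using that by (auto simp: proper_colorings_def induced_def)
      have "f v < q" if "v \<in> W" "f v \<noteq> q" for v
        using lt[OF that(1)] that(2) by simp
      moreover have ne: "f x \<noteq> f y" if "(x, y) \<in> parcs G" "x \<in> W" "y \<in> W" for x y
        using f that by (auto simp: proper_colorings_def induced_def)
      moreover have "Restr (parcs G) {v \<in> W. f v = q} = {}"
        using ne by fastforce
      ultimately show "?f f \<in> ?S"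
        using f by (auto simp: proper_colorings_def induced_def independent_sets_def)
    qed
    show "?g ` ?S \<subseteq> proper_colorings (induced G W) (Suc q)"
    proof (rule image_subsetI)
      fix p assume "p \<in> ?S"
      then obtain T h where p: "p = (T, h)" "T \<subseteq> W" "Restr (parcs G) T = {}"
          "h \<in> (W - T) \<rightarrow>\<^sub>E {..<q}" "\<forall>(x, y) \<in> Restr (parcs G) (W - T). h x \<noteq> h y"
        by (auto simp: proper_colorings_def induced_def independent_sets_def)
      have lt: "h v < q" if "v \<in> W" "v \<notin> T" for v
        using p(4) that by auto
      have ne: "?g p x \<noteq> ?g p y" if "(x, y) \<in> parcs G" "x \<in> W" "y \<in> W" for x y
        using p(3,5) lt[of x] lt[of y] that by (auto simp: p(1))
      have "?g p \<in> W \<rightarrow>\<^sub>E {..<Suc q}"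
        using lt by (auto simp: p(1) less_SucI)
      with ne show "?g p \<in> proper_colorings (induced G W) (Suc q)"
        unfolding proper_colorings_def induced_def by auto
    qed
  qed
  then have "card (proper_colorings (induced G W) (Suc q)) = card ?S"
    by (rule bij_betw_same_card)
  also have "\<dots> = (\<Sum>T\<in>independent_sets W (parcs G). card (proper_colorings (induced G (W - T)) q))"
    using W by (intro card_SigmaI finite_independent_sets ballI finite_proper_colorings)
      (auto simp: induced_def)
  finally show ?thesis .
qed

lemma poly_eq_if_eq_at_nats:
  fixes p q :: "int poly"
  assumes "\<And>n. poly p (int n) = poly q (int n)"
  shows "p = q"
proof (rule ccontr)
  assume "p \<noteq> q"
  then have "finite {x. poly (p - q) x = 0}" by (intro poly_roots_finite) simp
  moreover have "range int \<subseteq> {x. poly (p - q) x = 0}" using assms by auto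
  ultimately have "finite (range int)" by (rule rev_finite_subset)
  then show False using finite_imageD[of int UNIV] by (simp add: inj_on_def)
qed

text \<open>
  Both sides are polynomials in \<open>x\<close> that agree at all natural numbers, so the splitting of colourings
  may be evaluated at negative integers as well.
\<close>

lemma chromatic_polynomial_shift:
  assumes G: "pair_graph G" and W: "W \<subseteq> pverts G"
  shows "poly (chromatic_polynomial (induced G W)) (x + 1) =
           (\<Sum>T\<in>independent_sets W (parcs G). poly (chromatic_polynomial (induced G (W - T))) x)"
proof -
  interpret pair_graph G by fact
  have fin: "finite W" using W pair_finite_verts finite_subset by blast
  define p where "p = chromatic_polynomial (induced G W) \<circ>\<^sub>p [:1, 1:]"
  define q where "q = (\<Sum>T\<in>independent_sets W (parcs G). chromatic_polynomial (induced G (W - T)))"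
  have val: "poly (chromatic_polynomial (induced G U)) (int n) =
               int (card (proper_colorings (induced G U) n))" if "U \<subseteq> W" for U n
    using that W by (intro poly_chromatic_polynomial pair_graph_induced[OF G]) auto
  have "p = q"
  proof (rule poly_eq_if_eq_at_nats)
    fix n
    have "poly p (int n) = poly (chromatic_polynomial (induced G W)) (int (Suc n))"
      by (simp add: p_def poly_pcompose)
    also have "\<dots> = (\<Sum>T\<in>independent_sets W (parcs G).
                        int (card (proper_colorings (induced G (W - T)) n)))"
      by (simp only: val[OF order_refl] card_proper_colorings_Suc[OF fin] of_nat_sum)
    also have "\<dots> = poly q (int n)"
      by (simp add: q_def poly_sum val)
    finally show "poly p (int n) = poly q (int n)" .
  qed
  then have "poly p x = poly q x" by simp
  then show ?thesis by (simp add: p_def q_def poly_pcompose poly_sum add.commute)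
qed

section \<open>Stanley's reciprocity theorem\<close>

definition acyclic_orientations :: "'a rel \<Rightarrow> 'a rel set" where
  "acyclic_orientations E =
     {A. A \<subseteq> E \<and> (\<forall>(x, y) \<in> E. (x, y) \<in> A \<longleftrightarrow> (y, x) \<notin> A) \<and> acyclic A}"

definition descending_pairs :: "'a set \<Rightarrow> 'a rel \<Rightarrow> nat \<Rightarrow> ('a rel \<times> ('a \<Rightarrow> nat)) set" where
  "descending_pairs V E k =
     {(A, c). A \<in> acyclic_orientations E \<and> c \<in> V \<rightarrow>\<^sub>E {..<k} \<and> (\<forall>(x, y) \<in> A. c y \<le> c x)}"

lemma mem_descending_pairs:
  "(A, c) \<in> descending_pairs V E k \<longleftrightarrow>
     A \<subseteq> E \<and> (\<forall>x y. (x, y) \<in> E \<longrightarrow> ((x, y) \<in> A \<longleftrightarrow> (y, x) \<notin> A)) \<and> acyclic A \<and>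
     c \<in> V \<rightarrow>\<^sub>E {..<k} \<and> (\<forall>x y. (x, y) \<in> A \<longrightarrow> c y \<le> c x)"
  by (auto simp: descending_pairs_def acyclic_orientations_def)

definition top_sources :: "'a set \<Rightarrow> nat \<Rightarrow> 'a rel \<times> ('a \<Rightarrow> nat) \<Rightarrow> 'a set" where
  "top_sources V k = (\<lambda>(A, c). {v \<in> V. c v = k \<and> v \<notin> Range A})"

lemma finite_descending_pairs:
  assumes "finite V" "finite E"
  shows "finite (descending_pairs V E k)"
  by (rule finite_subset[of _ "Pow E \<times> (V \<rightarrow>\<^sub>E {..<k})"])
    (use assms in \<open>auto simp: descending_pairs_def acyclic_orientations_def finite_PiE\<close>)

lemma sum_minus_one_power_card_Pow:
  assumes "finite M"
  shows "(\<Sum>T\<in>Pow M. (-1) ^ card T) = (of_bool (M = {}) :: int)"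
  using prod_diff_conv_sum[OF assms, of "\<lambda>_. 1 :: int" "\<lambda>_. 1"] assms
  by (cases "M = {}") (auto simp: card_gt_0_iff zero_power)

text \<open>
  An independent set can be put on top of a descending pair in exactly one way: its members become
  sources and get the top colour, which cannot violate the descent along their outgoing arcs.
\<close>

lemma card_descending_pairs_top_sources:
  assumes V: "E \<subseteq> V \<times> V" "finite V" and sym: "sym E" and T: "T \<in> independent_sets V E"
  shows "card {p \<in> descending_pairs V E (Suc k). T \<subseteq> top_sources V k p} =
           card (descending_pairs (V - T) (Restr E (V - T)) (Suc k))"
proof -
  let ?P = "{p \<in> descending_pairs V E (Suc k). T \<subseteq> top_sources V k p}"
  let ?Q = "descending_pairs (V - T) (Restr E (V - T)) (Suc k)"
  let ?O = "E \<inter> T \<times> UNIV"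
  let ?f = "\<lambda>(B, g). (B \<union> ?O, \<lambda>v\<in>V. if v \<in> T then k else g v)"
  let ?h = "\<lambda>(A, c). (Restr A (V - T), restrict c (V - T))"
  have TV: "T \<subseteq> V" and ind: "\<And>x y. (x, y) \<in> E \<Longrightarrow> x \<in> T \<Longrightarrow> y \<notin> T"
    using T by (auto simp: independent_sets_def)
  have E': "\<And>x y. (x, y) \<in> E \<Longrightarrow> x \<in> V \<and> y \<in> V" using V by auto
  have sym': "\<And>x y. (x, y) \<in> E \<Longrightarrow> (y, x) \<in> E" using sym by (auto dest: symD)
  have finE: "finite E" using V finite_subset by blast
  \<comment> \<open>The new arcs lead from \<open>T\<close> to its complement and no old arc enters \<open>T\<close>, so no cycle can arise.\<close>
  have wfO: "wf ?O"
  proof -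
    have "acyclic ?O"
      by (rule acyclicI_order[where f = "\<lambda>v. of_bool (v \<in> T) :: nat"]) (auto dest: ind)
    then show ?thesis using finE by (intro finite_acyclic_wf) auto
  qed
  have "bij_betw ?f ?Q ?P"
  proof (rule bij_betw_byWitness[where f' = ?h])
    show "\<forall>q\<in>?Q. ?h (?f q) = q"
    proof
      fix q assume "q \<in> ?Q"
      then obtain B g where q: "q = (B, g)" "B \<subseteq> Restr E (V - T)" "g \<in> (V - T) \<rightarrow>\<^sub>E {..<Suc k}"
        by (auto simp: descending_pairs_def acyclic_orientations_def)
      have "restrict (\<lambda>v\<in>V. if v \<in> T then k else g v) (V - T) = g"
        using q(3) by (auto simp: fun_eq_iff PiE_def extensional_def)
      then show "?h (?f q) = q" using q(2) by (auto simp: q(1))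
    qed
    show "\<forall>p\<in>?P. ?f (?h p) = p"
    proof
      fix p assume "p \<in> ?P"
      then obtain A c where p: "p = (A, c)" "A \<subseteq> E"
          "\<And>x y. (x, y) \<in> E \<Longrightarrow> (x, y) \<in> A \<longleftrightarrow> (y, x) \<notin> A"
          "c \<in> V \<rightarrow>\<^sub>E {..<Suc k}" "\<And>v. v \<in> T \<Longrightarrow> c v = k" "\<And>v. v \<in> T \<Longrightarrow> v \<notin> Range A"
        by (fastforce simp: descending_pairs_def acyclic_orientations_def top_sources_def)
      have "(\<lambda>v\<in>V. if v \<in> T then k else restrict c (V - T) v) = c"
        using p(4,5) by (auto simp: fun_eq_iff PiE_def extensional_def)
      moreover have "?O \<subseteq> A" using p(3,6) by auto
      moreover have "A \<subseteq> Restr A (V - T) \<union> ?O" using p(2,6) E' by auto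
      ultimately show "?f (?h p) = p" by (auto simp: p(1))
    qed
    show "?f ` ?Q \<subseteq> ?P"
    proof (rule image_subsetI)
      fix q assume "q \<in> ?Q"
      then obtain B g where q: "q = (B, g)" "B \<subseteq> Restr E (V - T)" "g \<in> (V - T) \<rightarrow>\<^sub>E {..<Suc k}"
          "\<And>x y. (x, y) \<in> Restr E (V - T) \<Longrightarrow> (x, y) \<in> B \<longleftrightarrow> (y, x) \<notin> B"
          "acyclic B" "\<And>x y. (x, y) \<in> B \<Longrightarrow> g y \<le> g x"
        by (fastforce simp: descending_pairs_def acyclic_orientations_def)
      let ?c = "\<lambda>v\<in>V. if v \<in> T then k else g v"
      have gk: "g v \<le> k" if "v \<in> V" "v \<notin> T" for v
        using q(3) that by (auto simp: less_Suc_eq_le)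
      have "finite B" using q(2) finE finite_subset[of B E] by auto
      then have "wf B" using q(5) by (rule finite_acyclic_wf)
      moreover have "Domain ?O \<inter> Range B = {}" using q(2) by auto
      ultimately have "acyclic (B \<union> ?O)"
        by (subst Un_commute, intro wf_acyclic wf_Un wfO)
      moreover have "(x, y) \<in> B \<union> ?O \<longleftrightarrow> (y, x) \<notin> B \<union> ?O" if xy: "(x, y) \<in> E" for x y
      proof (cases "x \<in> T \<or> y \<in> T")
        case True
        then show ?thesis using q(2) xy ind[OF xy] sym'[OF xy] by auto
      next
        case False
        then show ?thesis using q(4)[of x y] xy E'[OF xy] by auto
      qed
      moreover have "?c \<in> V \<rightarrow>\<^sub>E {..<Suc k}" using gk by (auto simp: less_Suc_eq_le)
      moreover have "?c y \<le> ?c x" if "(x, y) \<in> B \<union> ?O" for x y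
        using that q(2) q(6)[of x y] E'[of x y] gk by auto
      moreover have "B \<union> ?O \<subseteq> E" using q(2) by auto
      moreover have "T \<subseteq> top_sources V k (B \<union> ?O, ?c)"
        using TV q(2) by (auto simp: top_sources_def dest: ind)
      ultimately show "?f q \<in> ?P"
        unfolding q(1) prod.case mem_Collect_eq mem_descending_pairs by blast
    qed
    show "?h ` ?P \<subseteq> ?Q"
    proof (rule image_subsetI)
      fix p assume "p \<in> ?P"
      then obtain A c where p: "p = (A, c)" "A \<subseteq> E"
          "\<And>x y. (x, y) \<in> E \<Longrightarrow> (x, y) \<in> A \<longleftrightarrow> (y, x) \<notin> A"
          "acyclic A" "c \<in> V \<rightarrow>\<^sub>E {..<Suc k}" "\<And>x y. (x, y) \<in> A \<Longrightarrow> c y \<le> c x"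
        by (fastforce simp: descending_pairs_def acyclic_orientations_def)
      have "acyclic (Restr A (V - T))" using p(4) by (rule acyclic_subset) auto
      moreover have "restrict c (V - T) \<in> (V - T) \<rightarrow>\<^sub>E {..<Suc k}" using p(5) by auto
      ultimately show "?h p \<in> ?Q"
        using p(2,3,6) by (auto simp: p(1) descending_pairs_def acyclic_orientations_def)
    qed
  qed
  then show ?thesis by (rule bij_betw_same_card[symmetric])
qed

text \<open>
  If the top colour occurs, then walking backwards from a vertex of that colour never leaves the
  colour, and by acyclicity the walk ends in a source.
\<close>

lemma no_top_sources_iff:
  assumes V: "E \<subseteq> V \<times> V" "finite V"
  shows "{p \<in> descending_pairs V E (Suc k). top_sources V k p = {}} = descending_pairs V E k"
    (is "?L = ?R")
proof
  show "?L \<subseteq> ?R"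
  proof
    fix p assume "p \<in> ?L"
    then obtain A c where p: "p = (A, c)" "A \<in> acyclic_orientations E" "c \<in> V \<rightarrow>\<^sub>E {..<Suc k}"
        "\<forall>(x, y) \<in> A. c y \<le> c x" "top_sources V k (A, c) = {}"
      by (auto simp: descending_pairs_def)
    have AE: "A \<subseteq> E" and "acyclic A" using p(2) by (auto simp: acyclic_orientations_def)
    then have wf: "wf A" using V by (meson finite_SigmaI finite_acyclic_wf finite_subset)
    have ck: "c v \<le> k" if "v \<in> V" for v using p(3) that by (auto simp: less_Suc_eq_le)
    have "c v \<noteq> k" if "v \<in> V" for v
    proof
      assume "c v = k"
      with that have "v \<in> {v \<in> V. c v = k}" by simp
      from wfE_min[OF wf this] obtain z
        where z: "z \<in> V" "c z = k" and min: "\<And>y. (y, z) \<in> A \<Longrightarrow> y \<notin> {v \<in> V. c v = k}" by auto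
      have False if "(y, z) \<in> A" for y
      proof -
        have "y \<in> V" using that AE V by auto
        moreover have "k \<le> c y" using p(4) that z by auto
        ultimately show False using min[OF that] ck[of y] by auto
      qed
      then have "z \<in> top_sources V k (A, c)" using z by (auto simp: top_sources_def)
      then show False using p(5) by auto
    qed
    then have "c v < k" if "v \<in> V" for v
      using ck[OF that] that by (simp add: le_neq_implies_less)
    then have "c \<in> V \<rightarrow>\<^sub>E {..<k}" using p(3) by (auto simp: PiE_iff)
    then show "p \<in> ?R" using p by (auto simp: descending_pairs_def)
  qed
  show "?R \<subseteq> ?L"
  proof
    fix p assume "p \<in> ?R"
    then obtain A c where p: "p = (A, c)" "A \<in> acyclic_orientations E" "c \<in> V \<rightarrow>\<^sub>E {..<k}"
        "\<forall>(x, y) \<in> A. c y \<le> c x"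
      by (auto simp: descending_pairs_def)
    have lt: "c v < k" if "v \<in> V" for v using p(3) that by auto
    then have "c \<in> V \<rightarrow>\<^sub>E {..<Suc k}" using p(3) by (auto simp: PiE_iff less_SucI)
    moreover have "top_sources V k p = {}"
      using lt by (auto simp: p(1) top_sources_def)
    ultimately show "p \<in> ?L" using p by (auto simp: descending_pairs_def)
  qed
qed

text \<open>
  By the previous correspondence the sum ranges over the pairs on \<open>V\<close> with a marked independent set of
  sources of the top colour.  Any set of sources is independent, so for a fixed pair all subsets of its
  top-coloured sources occur, and their signs cancel unless there is no such source.
\<close>

lemma descending_pairs_alternating_sum:
  assumes V: "E \<subseteq> V \<times> V" "finite V" and sym: "sym E"
  shows "(\<Sum>T\<in>independent_sets V E.
            (-1) ^ card T * int (card (descending_pairs (V - T) (Restr E (V - T)) (Suc k)))) =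
         int (card (descending_pairs V E k))"
proof -
  let ?P = "descending_pairs V E (Suc k)"
  let ?M = "top_sources V k"
  have finP: "finite ?P" using V finite_subset by (intro finite_descending_pairs) blast+
  have MV: "?M p \<subseteq> V" for p by (auto simp: top_sources_def split: prod.splits)
  have ind: "T \<in> independent_sets V E" if "p \<in> ?P" "T \<subseteq> ?M p" for p T
  proof -
    obtain A c where p: "p = (A, c)" by (cases p)
    have "(x, y) \<in> A \<or> (y, x) \<in> A" if "(x, y) \<in> E" for x y
      using \<open>p \<in> ?P\<close> that by (auto simp: p descending_pairs_def acyclic_orientations_def)
    then show ?thesis
      using that(2) by (fastforce simp: p top_sources_def independent_sets_def)
  qed
  have "(\<Sum>T\<in>independent_sets V E.
            (-1) ^ card T * int (card (descending_pairs (V - T) (Restr E (V - T)) (Suc k)))) =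
        (\<Sum>T\<in>independent_sets V E. (-1) ^ card T * int (card {p \<in> ?P. T \<subseteq> ?M p}))"
    by (intro sum.cong refl) (simp add: card_descending_pairs_top_sources[OF V sym])
  also have "\<dots> = (\<Sum>T\<in>independent_sets V E. \<Sum>p\<in>?P. (-1) ^ card T * of_bool (T \<subseteq> ?M p))"
    using finP by (simp add: sum_distrib_left[symmetric] sum_of_bool_eq Int_def)
  also have "\<dots> = (\<Sum>p\<in>?P. \<Sum>T\<in>independent_sets V E. (-1) ^ card T * of_bool (T \<subseteq> ?M p))"
    by (rule sum.swap)
  also have "\<dots> = (\<Sum>p\<in>?P. \<Sum>T\<in>Pow (?M p). (-1) ^ card T)"
    using V by (intro sum.cong refl sum.mono_neutral_cong_right)
      (auto simp: finite_independent_sets intro: ind)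
  also have "\<dots> = (\<Sum>p\<in>?P. of_bool (?M p = {}))"
    using V MV by (intro sum.cong refl sum_minus_one_power_card_Pow) (blast intro: finite_subset)+
  also have "\<dots> = int (card {p \<in> ?P. ?M p = {}})"
    using finP by (simp add: sum_of_bool_eq Int_def)
  finally show ?thesis by (simp add: no_top_sources_iff[OF V])
qed

text \<open>
  With \<open>f(W, k)\<close> standing for either side, \<open>f(W, k) = \<Sum>\<^sub>T f(W - T, k + 1)\<close> over the independent
  sets \<open>T\<close>.  The summand for \<open>T = {}\<close> is \<open>f(W, k + 1)\<close>, so the recurrence determines this value from
  \<open>f(W, k)\<close> and from smaller sets; hence the outer induction on \<open>k\<close> and the inner one on the size of \<open>W\<close>.
\<close>

theorem chromatic_reciprocity:
  assumes G: "pair_graph G" and W: "W \<subseteq> pverts G"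
  shows "poly (chromatic_polynomial (induced G W)) (- int k) =
           (-1) ^ card W * int (card (descending_pairs W (Restr (parcs G) W) k))"
  using W
proof (induction k arbitrary: W)
  case 0
  interpret pair_graph G by fact
  have fin: "finite W" using 0 pair_finite_verts finite_subset by blast
  show ?case
  proof (cases "W = {}")
    case True
    then show ?thesis
      using poly_chromatic_polynomial[OF pair_graph_induced[OF G 0], of 0]
      by (simp add: proper_colorings_def induced_def descending_pairs_def acyclic_orientations_def
        wf_acyclic cong: conj_cong)
  next
    case False
    then have "W \<rightarrow>\<^sub>E {..<0 :: nat} = {}" by (auto simp: PiE_eq_empty_iff)
    then show ?thesis
      using poly_chromatic_polynomial[OF pair_graph_induced[OF G 0], of 0]
      by (simp add: proper_colorings_def induced_def descending_pairs_def)
  qed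
next
  case (Suc k)
  interpret pair_graph G by fact
  let ?E = "parcs G"
  let ?\<chi> = "\<lambda>W. poly (chromatic_polynomial (induced G W))"
  let ?N = "\<lambda>W k. int (card (descending_pairs W (Restr ?E W) k))"
  have symE: "sym ?E"
    using pair_sym_arcs by (simp add: symmetric_def)
  show ?case
    using Suc.prems
  proof (induction "card W" arbitrary: W rule: less_induct)
    case less
    have fin: "finite W" using less.prems pair_finite_verts finite_subset by blast
    let ?I = "independent_sets W ?E"
    have I: "?I = independent_sets W (Restr ?E W)" "finite ?I" "{} \<in> ?I"
      using fin by (auto simp: independent_sets_def finite_independent_sets)
    have smaller: "?\<chi> (W - T) (- int (Suc k)) = (-1) ^ card W * ((-1) ^ card T * ?N (W - T) (Suc k))"
      if T: "T \<in> ?I - {{}}" for T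
    proof -
      have TW: "T \<subseteq> W" "T \<noteq> {}" using T by (auto simp: independent_sets_def)
      have c: "card W = card (W - T) + card T"
        using fin TW by (metis card_Diff_subset card_mono finite_subset le_add_diff_inverse2)
      have "card T > 0" using TW fin finite_subset by (auto simp: card_gt_0_iff)
      then have "?\<chi> (W - T) (- int (Suc k)) = (-1) ^ card (W - T) * ?N (W - T) (Suc k)"
        using less.hyps[of "W - T"] c less.prems by auto
      also have "(-1 :: int) ^ card (W - T) = (-1) ^ card W * (-1) ^ card T"
        unfolding c by (simp add: power_add mult.assoc flip: power_mult_distrib)
      finally show ?thesis by (simp add: mult.assoc)
    qed
    have "(-1) ^ card W * ?N W k = ?\<chi> W (- int (Suc k) + 1)"
      using Suc.IH[OF less.prems] by simp
    also have "\<dots> = (\<Sum>T\<in>?I. ?\<chi> (W - T) (- int (Suc k)))"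
      by (rule chromatic_polynomial_shift[OF G less.prems])
    also have "\<dots> = ?\<chi> W (- int (Suc k)) + (\<Sum>T\<in>?I - {{}}. ?\<chi> (W - T) (- int (Suc k)))"
      using I(2,3) by (subst sum.remove[of _ "{}"]) auto
    also have "(\<Sum>T\<in>?I - {{}}. ?\<chi> (W - T) (- int (Suc k))) =
                 (-1) ^ card W * (\<Sum>T\<in>?I - {{}}. (-1) ^ card T * ?N (W - T) (Suc k))"
      unfolding sum_distrib_left by (intro sum.cong refl smaller)
    also have "(\<Sum>T\<in>?I - {{}}. (-1) ^ card T * ?N (W - T) (Suc k)) = ?N W k - ?N W (Suc k)"
    proof -
      have R: "Restr (Restr ?E W) (W - T) = Restr ?E (W - T)" for T by auto
      have "sym (Restr ?E W)" using symE by (auto simp: sym_def)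
      then have "?N W k = (\<Sum>T\<in>?I. (-1) ^ card T * ?N (W - T) (Suc k))"
        using descending_pairs_alternating_sum[of "Restr ?E W" W k] fin
        unfolding R I(1)[symmetric] by simp
      then show ?thesis using I(2,3) by (simp add: sum.remove[of _ "{}"])
    qed
    finally show ?case by (simp add: algebra_simps)
  qed
qed

section \<open>Compatible orientations of the cone\<close>

lemma source_iff_no_arc_into:
  "finite (parcs D) \<Longrightarrow> source D v \<longleftrightarrow> (\<forall>w. (w, v) \<notin> parcs D)"
  by (auto simp: source_def in_degree_def in_arcs_def)

lemma sink_iff_no_arc_out_of:
  "finite (parcs D) \<Longrightarrow> sink D v \<longleftrightarrow> (\<forall>w. (v, w) \<notin> parcs D)"
  by (auto simp: sink_def out_degree_def out_arcs_def)

text \<open>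
  Only the order of the boundary values matters, so they may be replaced by their ranks.
\<close>

lemma rank_function_exists:
  fixes u :: "nat \<Rightarrow> real"
  assumes "inj_on u {..k}"
  shows "\<exists>r. bij_betw r {..k} {..k} \<and> (\<forall>i\<le>k. \<forall>j\<le>k. r i < r j \<longleftrightarrow> u i < u j)"
proof -
  define r where "r i = card {j. j \<le> k \<and> u j < u i}" for i
  have mono: "r i < r j" if "u i < u j" "i \<le> k" for i j
    unfolding r_def by (rule psubset_card_mono) (use that in auto)
  have iff: "r i < r j \<longleftrightarrow> u i < u j" if "i \<le> k" "j \<le> k" for i j
    using mono[of i j] mono[of j i] that assms
    by (metis atMost_iff inj_onD less_irrefl less_asym linorder_neqE_linordered_idom)
  have "inj_on r {..k}"
  proof (rule inj_onI)
    fix i j assume ij: "i \<in> {..k}" "j \<in> {..k}" "r i = r j"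
    then have "u i = u j" using iff[of i j] iff[of j i] by force
    then show "i = j" using ij assms by (auto dest: inj_onD)
  qed
  moreover have "r i \<le> k" if "i \<le> k" for i
  proof -
    have "r i < card {..k}"
      unfolding r_def by (rule psubset_card_mono) (use that in auto)
    then show ?thesis by simp
  qed
  then have "r ` {..k} \<subseteq> {..k}" by auto
  ultimately have "bij_betw r {..k} {..k}"
    by (auto simp: bij_betw_def endo_inj_surj)
  with iff show ?thesis by blast
qed

text \<open>
  Place the boundary vertex \<open>Inr i\<close> at height \<open>r i - 1/2\<close> and a vertex \<open>v\<close> of \<open>G\<close> at height \<open>c v\<close>; then
  the edges between \<open>G\<close> and the boundary point downwards.
\<close>

definition cone_orientation ::
  "'a pair_pre_digraph \<Rightarrow> nat \<Rightarrow> (nat \<Rightarrow> nat) \<Rightarrow> 'a rel \<times> ('a \<Rightarrow> nat) \<Rightarrow> ('a + nat) pair_pre_digraph"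
where
  "cone_orientation G k r = (\<lambda>(A, c).
     \<lparr> pverts = pverts (cone_graph G k),
       parcs = map_prod Inl Inl ` A
             \<union> {(Inl v, Inr i) |v i. v \<in> pverts G \<and> i \<le> k \<and> r i \<le> c v}
             \<union> {(Inr i, Inl v) |v i. v \<in> pverts G \<and> i \<le> k \<and> c v < r i} \<rparr>)"

lemma parcs_cone_orientation [simp]:
  "(Inl x, Inl y) \<in> parcs (cone_orientation G k r (A, c)) \<longleftrightarrow> (x, y) \<in> A"
  "(Inl x, Inr i) \<in> parcs (cone_orientation G k r (A, c)) \<longleftrightarrow> x \<in> pverts G \<and> i \<le> k \<and> r i \<le> c x"
  "(Inr i, Inl x) \<in> parcs (cone_orientation G k r (A, c)) \<longleftrightarrow> x \<in> pverts G \<and> i \<le> k \<and> c x < r i"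
  "(Inr i, Inr j) \<notin> parcs (cone_orientation G k r (A, c))"
  by (auto simp: cone_orientation_def)

lemma parcs_cone_graph [simp]:
  "(Inl x, Inl y) \<in> parcs (cone_graph G k) \<longleftrightarrow> (x, y) \<in> parcs G"
  "(Inl x, Inr i) \<in> parcs (cone_graph G k) \<longleftrightarrow> x \<in> pverts G \<and> i \<le> k"
  "(Inr i, Inl x) \<in> parcs (cone_graph G k) \<longleftrightarrow> x \<in> pverts G \<and> i \<le> k"
  "(Inr i, Inr j) \<notin> parcs (cone_graph G k)"
  by (auto simp: cone_graph_def cone_boundary_def)

lemma inj_on_cone_orientation:
  assumes r: "bij_betw r {..k} {..k}"
  shows "inj_on (cone_orientation G k r) (descending_pairs (pverts G) E k)"
proof (rule inj_onI)
  fix p p' assume p: "p \<in> descending_pairs (pverts G) E k" "p' \<in> descending_pairs (pverts G) E k"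
    and eq: "cone_orientation G k r p = cone_orientation G k r p'"
  obtain A c A' c' where pp: "p = (A, c)" "p' = (A', c')" by (cases p, cases p')
  have c: "c \<in> pverts G \<rightarrow>\<^sub>E {..<k}" "c' \<in> pverts G \<rightarrow>\<^sub>E {..<k}"
    using p by (auto simp: pp descending_pairs_def)
  have "(x, y) \<in> A \<longleftrightarrow> (x, y) \<in> A'" for x y
    using arg_cong[OF eq, of "\<lambda>D. (Inl x, Inl y) \<in> parcs D"] by (simp add: pp)
  then have "A = A'" by auto
  moreover have "c = c'"
  proof (rule PiE_ext[OF c])
    fix v assume v: "v \<in> pverts G"
    have iff: "r i \<le> c v \<longleftrightarrow> r i \<le> c' v" if "i \<le> k" for i
      using arg_cong[OF eq, of "\<lambda>D. (Inl v, Inr i) \<in> parcs D"] that v by (simp add: pp)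
    \<comment> \<open>Every number up to \<open>k\<close> is a rank, so the arcs at \<open>v\<close> reveal the value of \<open>c\<close> at \<open>v\<close>.\<close>
    have iff': "n \<le> c v \<longleftrightarrow> n \<le> c' v" if "n \<le> k" for n
    proof -
      have "n \<in> r ` {..k}" using r that by (simp add: bij_betw_def)
      then show ?thesis using iff by auto
    qed
    have "c v < k" "c' v < k" using c v by auto
    then show "c v = c' v" using iff'[of "c v"] iff'[of "c' v"] by (simp add: order_antisym)
  qed
  ultimately show "p = p'" by (simp add: pp)
qed

text \<open>
  Along a directed path the height never increases, and it drops strictly on arcs that meet the
  boundary.  Hence a closed path could only use arcs of the acyclic relation \<open>A\<close>, and a path between
  boundary vertices goes down.  No vertex of \<open>G\<close> is a source or a sink, since all of them lie between
  the lowest and the highest boundary vertex.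
\<close>

lemma compatible_cone_orientation:
  fixes u :: "'a + nat \<Rightarrow> real"
  assumes G: "pair_graph G"
    and r: "bij_betw r {..k} {..k}"
    and ru: "\<And>i j. i \<le> k \<Longrightarrow> j \<le> k \<Longrightarrow> r i < r j \<longleftrightarrow> u (Inr i) < u (Inr j)"
    and p: "(A, c) \<in> descending_pairs (pverts G) (parcs G) k"
  shows "compatible_orientation (cone_graph G k) (cone_boundary k) u (cone_orientation G k r (A, c))"
    (is "compatible_orientation ?C ?B u ?D")
proof -
  interpret pair_graph G by fact
  interpret C: pair_graph ?C using G by (rule pair_graph_cone_graph)
  have A: "A \<subseteq> parcs G" "\<And>x y. (x, y) \<in> parcs G \<Longrightarrow> (x, y) \<in> A \<longleftrightarrow> (y, x) \<notin> A" "acyclic A"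
    and c: "\<And>v. v \<in> pverts G \<Longrightarrow> c v < k" and desc: "\<And>x y. (x, y) \<in> A \<Longrightarrow> c y \<le> c x"
    using p by (auto simp: descending_pairs_def acyclic_orientations_def)
  have sub: "parcs ?D \<subseteq> parcs ?C"
    using A(1) by (auto simp: cone_orientation_def)
  then have finD: "finite (parcs ?D)" using C.pair_finite_arcs finite_subset by blast
  have ori: "orientation ?C ?D"
    unfolding orientation_def
  proof (intro conjI sub)
    show "pverts ?D = pverts ?C" by (simp add: cone_orientation_def)
    have "(a, b) \<in> parcs ?D \<longleftrightarrow> (b, a) \<notin> parcs ?D" if "(a, b) \<in> parcs ?C" for a b
      using that A(2) by (cases a; cases b) auto
    then show "\<forall>(a, b)\<in>parcs ?C. (a, b) \<in> parcs ?D \<longleftrightarrow> (b, a) \<notin> parcs ?D" by auto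
  qed
  \<comment> \<open>Twice the height, to stay within the integers.\<close>
  define h where "h = case_sum (\<lambda>v. 2 * int (c v)) (\<lambda>i. 2 * int (r i) - 1)"
  have arc: "h b \<le> h a \<and> (h a = h b \<longrightarrow> (\<exists>x y. a = Inl x \<and> b = Inl y \<and> (x, y) \<in> A))"
    if "(a, b) \<in> parcs ?D" for a b
    using that desc by (cases a; cases b) (auto simp: h_def)
  have path: "h b \<le> h a \<and> (h a = h b \<longrightarrow> (\<exists>x y. a = Inl x \<and> b = Inl y \<and> (x, y) \<in> A\<^sup>+))"
    if "(a, b) \<in> (parcs ?D)\<^sup>+" for a b
    using that
  proof (induction rule: trancl_induct)
    case (base b)
    then show ?case using arc by blast
  next
    case (step b d)
    have le: "h d \<le> h b" "h b \<le> h a" using arc[OF step.hyps(2)] step.IH by auto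
    have "\<exists>x y. a = Inl x \<and> d = Inl y \<and> (x, y) \<in> A\<^sup>+" if "h a = h d"
    proof -
      from that le have "h a = h b" "h b = h d" by auto
      then obtain x y z where "a = Inl x" "b = Inl y" "(x, y) \<in> A\<^sup>+" "d = Inl z" "(y, z) \<in> A"
        using arc[OF step.hyps(2)] step.IH by auto
      then show ?thesis by (blast intro: trancl_into_trancl)
    qed
    then show ?case using le by auto
  qed
  have acyc: "acyclic (parcs ?D)"
    unfolding acyclic_def
  proof (intro allI notI)
    fix a assume "(a, a) \<in> (parcs ?D)\<^sup>+"
    then show False using path[of a a] A(3) by (auto simp: acyclic_def)
  qed
  have "\<not> source ?D v \<and> \<not> sink ?D v" if v: "v \<in> pverts ?C - ?B" for v
  proof -
    obtain x where x: "v = Inl x" "x \<in> pverts G" using v by (auto simp: cone_graph_def)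
    have "k \<in> r ` {..k}" "0 \<in> r ` {..k}" using r by (simp_all add: bij_betw_def)
    then obtain t b where "t \<le> k" "r t = k" "b \<le> k" "r b = 0" by auto
    then have "(Inr t, Inl x) \<in> parcs ?D" "(Inl x, Inr b) \<in> parcs ?D"
      using x c by auto
    then show ?thesis
      unfolding source_iff_no_arc_into[OF finD] sink_iff_no_arc_out_of[OF finD] x(1)
      by blast
  qed
  moreover have "\<not> u a \<le> u b" if ab: "a \<in> ?B" "b \<in> ?B" "(a, b) \<in> (parcs ?D)\<^sup>+" for a b
  proof -
    obtain i j where ij: "a = Inr i" "b = Inr j" "i \<le> k" "j \<le> k"
      using ab(1,2) by (auto simp: cone_boundary_def)
    then have "r j < r i" using path[OF ab(3)] by (auto simp: h_def)
    then show ?thesis using ru[of j i] ij by simp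
  qed
  ultimately show ?thesis
    using ori acyc by (auto simp: compatible_orientation_def arcs_ends_conv)
qed

text \<open>
  The boundary vertices that a vertex of \<open>G\<close> points to form an initial segment in the order of \<open>u\<close>,
  because a path through that vertex must go down; \<open>c\<close> records the highest rank in the segment.  The
  segment must be neither empty nor everything for this to be a value below \<open>k\<close>, which is where
  the absence of sources and sinks enters.
\<close>

lemma compatible_orientation_is_cone_orientation:
  fixes u :: "'a + nat \<Rightarrow> real"
  assumes G: "pair_graph G"
    and r: "bij_betw r {..k} {..k}"
    and ru: "\<And>i j. i \<le> k \<Longrightarrow> j \<le> k \<Longrightarrow> r i < r j \<longleftrightarrow> u (Inr i) < u (Inr j)"
    and comp: "compatible_orientation (cone_graph G k) (cone_boundary k) u D"
  shows "\<exists>p \<in> descending_pairs (pverts G) (parcs G) k. D = cone_orientation G k r p"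
proof -
  let ?C = "cone_graph G k" and ?V = "pverts G"
  interpret pair_graph G by fact
  interpret C: pair_graph ?C using G by (rule pair_graph_cone_graph)
  have vD: "pverts D = pverts ?C" and sub: "parcs D \<subseteq> parcs ?C"
    and ori: "\<And>a b. (a, b) \<in> parcs ?C \<Longrightarrow> (a, b) \<in> parcs D \<longleftrightarrow> (b, a) \<notin> parcs D"
    and acyc: "acyclic (parcs D)"
    using comp by (auto simp: compatible_orientation_def orientation_def)
  have finD: "finite (parcs D)" using sub C.pair_finite_arcs finite_subset by blast
  have inner: "\<exists>a. (a, Inl v) \<in> parcs D" "\<exists>b. (Inl v, b) \<in> parcs D" if "v \<in> ?V" for v
  proof -
    have "Inl v \<in> pverts ?C - cone_boundary k"
      using that by (auto simp: cone_graph_def cone_boundary_def)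
    then have "\<not> source D (Inl v) \<and> \<not> sink D (Inl v)"
      using comp by (auto simp: compatible_orientation_def)
    then show "\<exists>a. (a, Inl v) \<in> parcs D" "\<exists>b. (Inl v, b) \<in> parcs D"
      by (simp_all add: source_iff_no_arc_into[OF finD] sink_iff_no_arc_out_of[OF finD])
  qed
  have drop: "r j < r i" if path: "(Inr i, Inr j) \<in> (parcs D)\<^sup>+" and ij: "i \<le> k" "j \<le> k" for i j
  proof -
    have "i \<noteq> j" using acyc path by (auto simp: acyclic_def)
    moreover have "Inr i \<in> cone_boundary k" "Inr j \<in> cone_boundary k"
      using ij by (auto simp: cone_boundary_def)
    ultimately have "\<not> u (Inr i) \<le> u (Inr j)"
      using comp path by (auto simp: compatible_orientation_def arcs_ends_conv)
    then show ?thesis using ru[of j i] ij by simp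
  qed
  have rk: "r i \<le> k" if "i \<le> k" for i using r that by (auto simp: bij_betw_def)
  have "k \<in> r ` {..k}" "0 \<in> r ` {..k}" using r by (simp_all add: bij_betw_def)
  then obtain t b where t: "t \<le> k" "r t = k" and b: "b \<le> k" "r b = 0" by auto
  have arc: "x \<in> ?V \<and> y \<in> ?V" if "(Inl x, Inl y) \<in> parcs D" for x y
    using that sub arc_fst_in_verts arc_snd_in_verts by fastforce
  have flip: "(Inr i, Inl v) \<in> parcs D \<longleftrightarrow> (Inl v, Inr i) \<notin> parcs D" if "v \<in> ?V" "i \<le> k" for v i
    using ori[of "Inr i" "Inl v"] that by simp
  have bdry: "i \<le> k" if "(Inl v, Inr i) \<in> parcs D" for v i
    using that sub by auto
  have p2: "(x, z) \<in> (parcs D)\<^sup>+" if "(x, y) \<in> parcs D" "(y, z) \<in> parcs D" for x y z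
    using that by (meson r_into_trancl' trancl_into_trancl)
  have p3: "(x, w) \<in> (parcs D)\<^sup>+" if "(x, y) \<in> parcs D" "(y, z) \<in> parcs D" "(z, w) \<in> parcs D"
    for x y z w
    using p2[OF that(1,2)] that(3) by (rule trancl_into_trancl)

  define out where "out v = {i. (Inl v, Inr i) \<in> parcs D}" for v
  have out_k: "out v \<subseteq> {..k}" for v using bdry by (auto simp: out_def)
  \<comment> \<open>
    Take a vertex \<open>z\<close> pointing to the top boundary vertex \<open>t\<close>, none of whose predecessors does.  It is
    not a source; a predecessor in the boundary would have a path up to \<open>t\<close>, and a predecessor
    \<open>w\<close> in \<open>G\<close> would close the triangle from \<open>t\<close> over \<open>w\<close> and \<open>z\<close> back to \<open>t\<close>.
  \<close>
  have top: "t \<notin> out v" if "v \<in> ?V" for v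
  proof
    assume "t \<in> out v"
    with that have "Inl v \<in> {Inl v |v. v \<in> ?V \<and> t \<in> out v}" by auto
    from wfE_min[OF finite_acyclic_wf[OF finD acyc] this] obtain z
      where z: "z \<in> ?V" "t \<in> out z"
        and min: "\<And>a. (a, Inl z) \<in> parcs D \<Longrightarrow> a \<notin> {Inl v |v. v \<in> ?V \<and> t \<in> out v}" by auto
    obtain a where a: "(a, Inl z) \<in> parcs D" using inner(1)[OF z(1)] by auto
    have zt: "(Inl z, Inr t) \<in> parcs D" using z(2) by (simp add: out_def)
    show False
    proof (cases a)
      case (Inl w)
      then have "w \<in> ?V" using a arc by auto
      moreover have "t \<notin> out w" using min[OF a] Inl \<open>w \<in> ?V\<close> by auto
      ultimately have "(Inr t, Inl w) \<in> parcs D" using flip[of w t] t by (simp add: out_def)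
      then have "(Inr t, Inr t) \<in> (parcs D)\<^sup>+" using p3 a zt Inl by blast
      then show False using acyc by (auto simp: acyclic_def)
    next
      case (Inr i)
      then have i: "i \<le> k" using a sub by auto
      have "(Inr i, Inr t) \<in> (parcs D)\<^sup>+" using p2 a zt Inr by blast
      then show False using drop[of i t] i t rk[of i] by simp
    qed
  qed
  \<comment> \<open>The dual argument, with a last vertex that does not point to the bottom boundary vertex \<open>b\<close>.\<close>
  have bot: "b \<in> out v" if "v \<in> ?V" for v
  proof (rule ccontr)
    assume "b \<notin> out v"
    with that have "Inl v \<in> {Inl v |v. v \<in> ?V \<and> b \<notin> out v}" by auto
    from wfE_min[OF finite_acyclic_wf_converse[OF finD acyc] this] obtain z
      where z: "z \<in> ?V" "b \<notin> out z"
        and min: "\<And>a. (Inl z, a) \<in> parcs D \<Longrightarrow> a \<notin> {Inl v |v. v \<in> ?V \<and> b \<notin> out v}" by auto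
    obtain a where a: "(Inl z, a) \<in> parcs D" using inner(2)[OF z(1)] by auto
    have bz: "(Inr b, Inl z) \<in> parcs D" using z flip[of z b] b by (simp add: out_def)
    show False
    proof (cases a)
      case (Inl w)
      then have "w \<in> ?V" using a arc by auto
      then have "(Inl w, Inr b) \<in> parcs D" using min[OF a] Inl by (auto simp: out_def)
      then have "(Inr b, Inr b) \<in> (parcs D)\<^sup>+" using p3 a bz Inl by blast
      then show False using acyc by (auto simp: acyclic_def)
    next
      case (Inr i)
      then have i: "i \<le> k" using a bdry by auto
      have "(Inr b, Inr i) \<in> (parcs D)\<^sup>+" using p2 a bz Inr by blast
      then show False using drop[of b i] i b by simp
    qed
  qed

  define c where "c = (\<lambda>v\<in>?V. Max (r ` out v))"
  define A where "A = {(x, y). (Inl x, Inl y) \<in> parcs D}"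
  have finout: "finite (out v)" for v using out_k finite_subset by blast
  have threshold: "i \<in> out v \<longleftrightarrow> r i \<le> c v" if v: "v \<in> ?V" and i: "i \<le> k" for v i
  proof
    show "i \<in> out v \<Longrightarrow> r i \<le> c v" using v finout by (simp add: c_def)
  next
    assume "r i \<le> c v"
    moreover have "c v \<in> r ` out v"
      using bot[OF v] finout v by (auto simp: c_def intro!: Max_in)
    ultimately obtain j where j: "j \<in> out v" "r i \<le> r j" by auto
    show "i \<in> out v"
    proof (rule ccontr)
      assume "i \<notin> out v"
      then have "(Inr i, Inr j) \<in> (parcs D)\<^sup>+" using p2 flip[OF v i] j(1) by (auto simp: out_def)
      moreover have "j \<le> k" using j(1) out_k by auto
      ultimately show False using drop[of i j] i j(2) by simp
    qed
  qed
  have "c v < k" if "v \<in> ?V" for v using threshold[OF that t(1)] top[OF that] t(2) by simp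
  then have c: "c \<in> ?V \<rightarrow>\<^sub>E {..<k}" by (auto simp: c_def)
  have "c y \<le> c x" if xy: "(x, y) \<in> A" for x y
  proof -
    have V: "x \<in> ?V" "y \<in> ?V" using xy arc by (auto simp: A_def)
    have "out y \<subseteq> out x"
    proof (rule subsetI, rule ccontr)
      fix i assume i: "i \<in> out y" "i \<notin> out x"
      have "i \<le> k" using i out_k by auto
      then have "(Inr i, Inl x) \<in> parcs D" using flip[OF V(1)] i by (simp add: out_def)
      then have "(Inr i, Inr i) \<in> (parcs D)\<^sup>+"
        using p3 xy i by (fastforce simp: A_def out_def)
      then show False using acyc by (auto simp: acyclic_def)
    qed
    then show ?thesis
      using V bot[OF V(2)] finout by (auto simp: c_def intro!: Max_mono)
  qed
  moreover have "acyclic A"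
  proof (rule acyclicI, intro allI notI)
    fix x assume "(x, x) \<in> A\<^sup>+"
    moreover have "(Inl x, Inl y) \<in> (parcs D)\<^sup>+" if "(x, y) \<in> A\<^sup>+" for x y
      using that
      by (induction rule: trancl_induct) (auto simp: A_def intro: trancl_into_trancl)
    ultimately show False using acyc by (auto simp: acyclic_def)
  qed
  moreover have "A \<subseteq> parcs G" using sub by (auto simp: A_def)
  moreover have "(x, y) \<in> A \<longleftrightarrow> (y, x) \<notin> A" if "(x, y) \<in> parcs G" for x y
    using ori[of "Inl x" "Inl y"] that by (simp add: A_def)
  ultimately have "(A, c) \<in> descending_pairs ?V (parcs G) k"
    using c by (auto simp: descending_pairs_def acyclic_orientations_def)
  moreover have "D = cone_orientation G k r (A, c)"
  proof (rule pair_pre_digraph.equality)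
    show "pverts D = pverts (cone_orientation G k r (A, c))"
      by (simp add: vD cone_orientation_def)
    have "(a, d) \<in> parcs D \<longleftrightarrow> (a, d) \<in> parcs (cone_orientation G k r (A, c))" for a d
    proof (cases "(a, d) \<in> parcs ?C")
      case True
      then show ?thesis
        using flip threshold
        by (cases a; cases d) (auto simp: A_def out_def not_le)
    next
      case False
      then show ?thesis
        using sub by (cases a; cases d) (auto simp: A_def)
    qed
    then show "parcs D = parcs (cone_orientation G k r (A, c))" by auto
  qed simp
  ultimately show ?thesis by blast
qed

theorem theorem8:
  fixes G :: "'a pair_pre_digraph"
    and k :: nat
    and u :: "'a + nat \<Rightarrow> real"
  assumes "pair_graph G"
    and "k \<ge> 1"
    and "inj_on u (cone_boundary k)"
  shows "\<bar>poly (chromatic_polynomial G) (- int k)\<bar> =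
           int (card {D. compatible_orientation (cone_graph G k) (cone_boundary k) u D})"
proof -
  interpret pair_graph G by fact
  have "inj_on (u \<circ> Inr) {..k}"
    using assms(3) by (auto simp: cone_boundary_def inj_on_def)
  then obtain r where r: "bij_betw r {..k} {..k}"
      and ru: "\<And>i j. i \<le> k \<Longrightarrow> j \<le> k \<Longrightarrow> r i < r j \<longleftrightarrow> u (Inr i) < u (Inr j)"
    using rank_function_exists[of "u \<circ> Inr" k] by auto
  let ?P = "descending_pairs (pverts G) (parcs G) k"
  have "{D. compatible_orientation (cone_graph G k) (cone_boundary k) u D} = cone_orientation G k r ` ?P"
  proof (intro equalityI subsetI)
    fix D assume "D \<in> {D. compatible_orientation (cone_graph G k) (cone_boundary k) u D}"
    then show "D \<in> cone_orientation G k r ` ?P"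
      using compatible_orientation_is_cone_orientation[OF assms(1) r ru] by blast
  next
    fix D assume "D \<in> cone_orientation G k r ` ?P"
    then obtain A c where "(A, c) \<in> ?P" "D = cone_orientation G k r (A, c)" by auto
    then show "D \<in> {D. compatible_orientation (cone_graph G k) (cone_boundary k) u D}"
      using compatible_cone_orientation[OF assms(1) r ru] by blast
  qed
  then have "card {D. compatible_orientation (cone_graph G k) (cone_boundary k) u D} = card ?P"
    by (simp add: card_image inj_on_cone_orientation[OF r])
  moreover have "Restr (parcs G) (pverts G) = parcs G"
    using induced_pverts[OF assms(1)] by (metis induced_def pair_pre_digraph.select_convs(2))
  then have "poly (chromatic_polynomial G) (- int k) = (-1) ^ card (pverts G) * int (card ?P)"
    using chromatic_reciprocity[OF assms(1) order_refl, of k] by (simp add: induced_pverts[OF assms(1)])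
  ultimately show ?thesis by (simp add: abs_mult power_abs)
qed

end
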